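(* Let $k\ge3$, and let $G=K_{n_1,\ldots,n_s}$ be a complete multipartite graph with $s\ge 1$ nonempty partite classes. Then $G$ is an exact $k$-leaf power if and only if either $k$ is even or $s\le2$.
   Context: Graphs are finite, simple, undirected. A graph $G$ is an exact $k$-leaf power if there is a tree $T$ whose leaf set is $V(G)$ such that for distinct $u,v\in V(G)$, $uv\in E(G)$ if and only if $\operatorname{dist}_T(u,v)=k$; the vertex of a one-vertex tree counts as a leaf. $K_{n_1,\ldots,n_s}$ is the graph whose vertex set is a disjoint union of classes of sizes $n_1,\ldots,n_s$, two vertices being adjacent exactly when they lie in different classes (for $s=1$ it is edgeless). *)

theory Defs
  imports "Graph_Theory.Graph_Theory" "HOL-Library.Disjoint_Sets"
begin

text \<open>
  Finite simple undirected graphs are the finite, symmetric, loop-free digraphs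
  without parallel arcs of \<^locale>\<open>pair_graph\<close>: an edge \<open>uv\<close> is the
  pair of arcs \<open>(u,v)\<close>, \<open>(v,u)\<close>.
\<close>

text \<open>
  The library predicate \<^const>\<open>tree\<close> concerns digraphs: every edge of a symmetric
  digraph gives the closed walk \<open>u, v, u\<close>, which counts there as a cycle. The cycles
  of an undirected simple graph are the library cycles of length at least 3.
\<close>
definition undirected_tree :: "'a pair_pre_digraph \<Rightarrow> bool" where
  "undirected_tree T \<longleftrightarrow> pair_graph T \<and> Digraph_Component.connected (with_proj T) \<and>
     \<not> (\<exists>p. pre_digraph.cycle (with_proj T) p \<and> 3 \<le> length p)"

text \<open>
  In a symmetric digraph the out-degree is the degree of the undirected graph.
  The second disjunct makes the vertex of a one-vertex tree a leaf.
\<close>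
definition leaves :: "'a pair_pre_digraph \<Rightarrow> 'a set" where
  "leaves T = {v \<in> pverts T. out_degree (with_proj T) v = 1 \<or> pverts T = {v}}"

text \<open>The library's shortest-path distance, with all arcs of weight 1.\<close>
definition graph_dist :: "'a pair_pre_digraph \<Rightarrow> 'a \<Rightarrow> 'a \<Rightarrow> ereal" where
  "graph_dist G u v = wf_digraph.\<mu> (with_proj G) (\<lambda>_. 1) u v"

text \<open>
  The leaf set of \<open>T\<close> is the vertex set of \<open>G\<close>, embedded by \<^const>\<open>Inl\<close>.
  The summand \<^typ>\<open>nat\<close> supplies the inner vertices: every finite tree
  with leaf set \<open>V(G)\<close> has a copy of this form, even if the type \<open>'a\<close> is finite.
\<close>
definition exact_leaf_power :: "nat \<Rightarrow> 'a pair_pre_digraph \<Rightarrow> bool" where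
  "exact_leaf_power k G \<longleftrightarrow>
     (\<exists>T :: ('a + nat) pair_pre_digraph.
        undirected_tree T \<and> leaves T = Inl ` pverts G \<and>
        (\<forall>u \<in> pverts G. \<forall>v \<in> pverts G. u \<noteq> v \<longrightarrow>
           ((u, v) \<in> parcs G \<longleftrightarrow> graph_dist T (Inl u) (Inl v) = ereal (real k))))"

text \<open>
  \<open>G\<close> is (a copy of) \<open>K\<^bsub>n\<^sub>1,\<dots>,n\<^sub>s\<^esub>\<close>, where \<open>ns = [n\<^sub>1, \<dots>, n\<^sub>s]\<close>. The classes are
  finite because \<open>G\<close> is, so \<^const>\<open>card\<close> is their actual size.
\<close>
definition complete_multipartite :: "nat list \<Rightarrow> 'a pair_pre_digraph \<Rightarrow> bool" where
  "complete_multipartite ns G \<longleftrightarrow> pair_graph G \<and>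
     (\<exists>V :: nat \<Rightarrow> 'a set.
        pverts G = (\<Union>i<length ns. V i) \<and>
        disjoint_family_on V {..<length ns} \<and>
        (\<forall>i<length ns. card (V i) = ns ! i) \<and>
        parcs G = {(u, v). \<exists>i<length ns. \<exists>j<length ns. i \<noteq> j \<and> u \<in> V i \<and> v \<in> V j})"

end

theory Submission
  imports Defs
begin

text \<open>
  Suppose that a tree represents \<open>G\<close> and that there are at least three classes. Pick a vertex from
  each of three classes. These three leaves have pairwise distance \<open>k\<close>, so three shortest walks
  between them close up to a walk of length \<open>3 * k\<close>. A closed walk of odd length contains an odd cycle, and a tree has none, so \<open>k\<close>
  is even (\<open>no_three_equidistant_odd\<close>).

  Conversely, take a spider whose leg number \<open>i\<close> has length \<open>d i\<close>, and attach the
  vertices of class \<open>i\<close> as leaves to the foot of that leg. Two leaves of the same class have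
  distance 2, which is less than \<open>k\<close>, and leaves of different classes \<open>i\<close> and \<open>j\<close> have distance
  \<open>d i + d j + 2\<close> (\<open>tufted_spider\<close>). It remains to make this sum equal to \<open>k\<close> for all
  \<open>i \<noteq> j\<close>: if \<open>k\<close> is even, all legs may have length \<open>k div 2 - 1\<close>; for two classes and any \<open>k\<close>,
  lengths \<open>0\<close> and \<open>k - 2\<close> work; for a single class there is no condition, and a star serves.
  The body of the spider must not become a leaf itself, so it needs two neighbours. This fails only
  for the one-vertex graph, which is represented by the one-vertex tree.

  Spiders are described by their parent function towards the body. For such a description
  (locale \<open>parent_tree\<close>), acyclicity holds because a vertex of maximal depth on a cycle would have
  two neighbours on it that are both its parent, and the distance between different branches at the
  root is bounded below by a 1-Lipschitz function, the depth taken with a negative sign on one of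
  the two branches.
\<close>

section \<open>Walks, distances and leaves\<close>

text \<open>
  A closed walk that repeats a vertex splits into two shorter closed walks, and one of them has
  odd length.
\<close>
lemma (in wf_digraph) odd_closed_walk_imp_odd_cycle:
  assumes "awalk u p u" and "odd (length p)"
  shows "\<exists>c. cycle c \<and> odd (length c)"
  using assms
proof (induct "length p" arbitrary: u p rule: less_induct)
  case less
  from less.prems obtain e es where p: "p = e # es" by (cases p) auto
  show ?case
  proof (cases "distinct (tl (awalk_verts u p))")
    case True
    with less.prems p show ?thesis unfolding cycle_def by blast
  next
    case False
    with p less.prems have walk: "awalk (head G e) es u"
      and "\<not> distinct (awalk_verts (head G e) es)"
      by (auto simp: awalk_Cons_iff)
    from awalk_not_distinct_decomp[OF this]
    obtain q r s w where dec: "es = q @ r @ s" "0 < length r" "awalk (head G e) q w"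
      "awalk w r w" "awalk w s u"
      by (elim exE conjE) (rule that)
    show ?thesis
    proof (cases "odd (length r)")
      case True
      with less.hyps[of r w] dec p show ?thesis by simp
    next
      case False
      have "awalk u (e # q @ s) u"
        using less.prems(1) p dec by (simp add: awalk_Cons_iff awalk_appendI del: awalk_append_iff)
      moreover have "odd (length (e # q @ s))" using False less.prems(2) p dec by simp
      moreover have "length (e # q @ s) < length p" using p dec by simp
      ultimately show ?thesis using less.hyps by blast
    qed
  qed
qed

lemma (in wf_digraph) awalk_cost_unit: "awalk_cost (\<lambda>_. 1) p = real (length p)"
  by (induct p) auto

context pair_graph
begin

lemma graph_dist_le_walk:
  assumes "awalk u p v"
  shows "graph_dist G u v \<le> ereal (real (length p))"
  using min_cost_le_walk_cost[OF assms, of "\<lambda>_. 1"]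
  by (simp add: graph_dist_def awalk_cost_unit)

text \<open>
  The distance is defined as an infimum over walks; it is finite only if there is a walk, and in a
  finite graph it is then a minimum.
\<close>
lemma graph_dist_attained:
  assumes "graph_dist G u v = ereal x"
  obtains p where "awalk u p v" "x = real (length p)"
proof -
  have "u \<rightarrow>\<^sup>*\<^bsub>with_proj G\<^esub> v"
    using assms shortest_path_inf[of u v "\<lambda>_. 1"] by (auto simp: graph_dist_def)
  from min_cost_awalk[OF this, of "\<lambda>_. 1"] assms that show ?thesis
    by (auto simp: graph_dist_def awalk_cost_unit apath_def)
qed

lemma lipschitz_le_walk_length:
  fixes f :: "'a \<Rightarrow> int"
  assumes "\<And>x y. (x, y) \<in> parcs G \<Longrightarrow> f y - f x \<le> 1"
    and "awalk u p v"
  shows "f v - f u \<le> int (length p)"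
  using assms(2)
proof (induct p arbitrary: u)
  case (Cons e p)
  then show ?case using assms(1)[of "fst e" "snd e"] by (force simp: awalk_Cons_iff)
qed (simp add: awalk_Nil_iff)

text \<open>
  This gives lower bounds on distances without an analysis of all walks: a function that grows by
  at most 1 along every arc certifies one.
\<close>
lemma lipschitz_le_graph_dist:
  fixes f :: "'a \<Rightarrow> int"
  assumes "\<And>x y. (x, y) \<in> parcs G \<Longrightarrow> f y - f x \<le> 1"
  shows "ereal (real_of_int (f v - f u)) \<le> graph_dist G u v"
  unfolding graph_dist_def \<mu>_def
proof (rule INF_greatest)
  fix p assume "p \<in> {p. awalk u p v}"
  then have "f v - f u \<le> int (length p)" using lipschitz_le_walk_length[of f u p v] assms by blast
  then have "real_of_int (f v - f u) \<le> real_of_int (int (length p))"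
    by (simp only: of_int_le_iff)
  then show "ereal (real_of_int (f v - f u)) \<le> ereal (awalk_cost (\<lambda>_. 1) p)"
    by (simp add: awalk_cost_unit)
qed

lemma two_neighbours_not_leaf:
  assumes "(x, y) \<in> parcs G" "(x, z) \<in> parcs G" "y \<noteq> z"
  shows "x \<notin> leaves G"
proof
  assume leaf: "x \<in> leaves G"
  have "card {(x, y), (x, z)} \<le> card (out_arcs G x)"
    using assms by (intro card_mono) (auto simp: pair_finite_arcs out_arcs_def)
  then have "out_degree G x \<noteq> 1" using assms by (simp add: out_degree_def)
  moreover have "pverts G \<noteq> {x}" using in_arcsD2[OF assms(1)] in_arcsD2[OF assms(2)] assms(3) by auto
  ultimately show False using leaf by (simp add: leaves_def)
qed

end

lemma undirected_tree_no_odd_closed_walk: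
  assumes "undirected_tree T" "pre_digraph.awalk (with_proj T) u p u"
  shows "even (length p)"
proof (rule ccontr)
  interpret pair_graph T using assms(1) by (simp add: undirected_tree_def)
  assume "odd (length p)"
  then obtain c where c: "cycle c" "odd (length c)"
    using assms(2) odd_closed_walk_imp_odd_cycle by blast
  then have "length c \<ge> 2" unfolding cycle_digraph_conv by blast
  \<comment> \<open>A tree only lacks the cycles of length at least 3; without loops, every odd cycle is one.\<close>
  with c(2) have "length c \<ge> 3" by (cases "length c = 2") auto
  with c(1) assms(1) show False unfolding undirected_tree_def by blast
qed

lemma no_three_equidistant_odd:
  assumes "undirected_tree T" "odd k"
    and "graph_dist T u v = ereal (real k)" "graph_dist T v w = ereal (real k)"
      "graph_dist T w u = ereal (real k)"
  shows False
proof -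
  interpret pair_graph T using assms(1) by (simp add: undirected_tree_def)
  obtain p where p: "awalk u p v" "real k = real (length p)"
    by (rule graph_dist_attained[OF assms(3)])
  obtain q where q: "awalk v q w" "real k = real (length q)"
    by (rule graph_dist_attained[OF assms(4)])
  obtain r where r: "awalk w r u" "real k = real (length r)"
    by (rule graph_dist_attained[OF assms(5)])
  have "awalk u (p @ q @ r) u" by (rule awalk_appendI[OF p(1) awalk_appendI[OF q(1) r(1)]])
  from undirected_tree_no_odd_closed_walk[OF assms(1) this]
  have "even (length p + (length q + length r))" unfolding length_append .
  moreover have "length p = k" "length q = k" "length r = k"
    using p(2) q(2) r(2) by linarith+
  ultimately show False using assms(2) by simp
qed

section \<open>Trees from parent functions\<close>

text \<open>
  Because the depth drops by 1 from a vertex to its parent, iterating \<open>par\<close> reaches the root; this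
  makes the graph connected and acyclic.
\<close>
locale parent_tree =
  fixes V :: "'v set" and root :: 'v and par :: "'v \<Rightarrow> 'v" and depth :: "'v \<Rightarrow> nat"
  assumes finite_V: "finite V"
    and root_in: "root \<in> V"
    and par_in: "\<And>x. x \<in> V \<Longrightarrow> x \<noteq> root \<Longrightarrow> par x \<in> V"
    and depth_root: "depth root = 0"
    and depth_par: "\<And>x. x \<in> V \<Longrightarrow> x \<noteq> root \<Longrightarrow> depth x = Suc (depth (par x))"
begin

definition T :: "'v pair_pre_digraph" where
  "T = \<lparr> pverts = V, parcs = (\<Union>x \<in> V - {root}. {(x, par x), (par x, x)}) \<rparr>"

lemma pverts_T [simp]: "pverts T = V"
  by (simp add: T_def)

lemma parcs_T_iff:
  "(x, y) \<in> parcs T \<longleftrightarrow>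
     x \<in> V \<and> x \<noteq> root \<and> y = par x \<or> y \<in> V \<and> y \<noteq> root \<and> x = par y"
  by (auto simp: T_def)

sublocale pair_graph T
proof unfold_locales
  fix e assume e: "e \<in> parcs T"
  then show "fst e \<in> pverts T" "snd e \<in> pverts T"
    by (cases e; force simp: parcs_T_iff par_in)+
  from e show "fst e \<noteq> snd e"
    using depth_par by (cases e) (force simp: parcs_T_iff)
next
  show "finite (pverts T)" using finite_V by simp
  show "finite (parcs T)" using finite_V by (simp add: T_def)
  show "symmetric (with_proj T)"
    by (auto simp: symmetric_def sym_def parcs_T_iff)
qed

lemma walk_to_root:
  assumes "x \<in> V"
  shows "\<exists>p. awalk x p root \<and> length p = depth x"
  using assms
proof (induct "depth x" arbitrary: x)
  case 0
  then have "x = root" using depth_par by force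
  then show ?case using root_in depth_root by (auto simp: awalk_Nil_iff)
next
  case (Suc n)
  then have "x \<noteq> root" using depth_root by auto
  then have d: "depth x = Suc (depth (par x))" "par x \<in> V" "(x, par x) \<in> parcs T"
    using Suc.prems depth_par par_in by (auto simp: parcs_T_iff)
  with Suc obtain p where "awalk (par x) p root" "length p = depth (par x)" by force
  with d have "awalk x ((x, par x) # p) root \<and> length ((x, par x) # p) = depth x"
    by (simp add: awalk_Cons_iff)
  then show ?case by blast
qed

lemma walk_via_root:
  assumes "x \<in> V" "y \<in> V"
  shows "\<exists>p. awalk x p y \<and> length p = depth x + depth y"
proof -
  obtain p q where p: "awalk x p root" "length p = depth x"
    and q: "awalk y q root" "length q = depth y"
    using walk_to_root[OF assms(1)] walk_to_root[OF assms(2)] by metis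
  have len: "length (rev_path es) = length es" for es :: "('v \<times> 'v) list"
    by (induct es) auto
  have "awalk x (p @ rev_path q) y"
    by (rule awalk_appendI[OF p(1)]) (simp add: q)
  moreover have "length (p @ rev_path q) = depth x + depth y"
    using p q by (simp add: len)
  ultimately show ?thesis by blast
qed

lemma connected_T: "Digraph_Component.connected (with_proj T)"
proof -
  have "x \<rightarrow>\<^sup>*\<^bsub>mk_symmetric (with_proj T)\<^esub> y" if xy: "x \<in> V" "y \<in> V" for x y
  proof -
    obtain p where "awalk x p y" using walk_via_root[OF xy] by (elim exE conjE) (rule that)
    from reachable_mk_symmetricI[OF reachable_awalkI[OF this]] show ?thesis .
  qed
  then show ?thesis
    using root_in by (auto simp: connected_def strongly_connected_def)
qed

text \<open>
  Let \<open>x\<close> be a vertex of maximal depth on a cycle. Its two neighbours on the cycle are not deeper,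
  so both are the parent of \<open>x\<close>. On a cycle of length at least 3 they would be distinct.
\<close>
lemma no_long_cycle:
  assumes "cycle p"
  shows "length p < 3"
proof (rule ccontr)
  assume long: "\<not> length p < 3"
  define n where "n = length p"
  have n: "n \<ge> 3" using long by (simp add: n_def)
  obtain u where walk: "awalk u p u" and dist: "distinct (tl (awalk_verts u p))"
    using assms by (auto simp: cycle_def)
  have "cas u p u" using walk by blast
  then have verts: "awalk_verts u p = u # map snd p"
    using n awalk_verts_conv'[of u p u] by (cases p) (auto simp: n_def)
  with dist have heads: "distinct (map snd p)" by simp
  have verts': "awalk_verts u p = map fst p @ [snd (last p)]"
    using n awalk_verts_conv[of u p] by (auto simp: n_def)
  \<comment> \<open>The cycle is indexed cyclically by the heads of its arcs, which avoids rotating it.\<close>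
  have nxt: "fst (p ! (Suc i mod n)) = snd (p ! i)" if "i < n" for i
  proof (cases "Suc i < n")
    case True
    have "fst (p ! Suc i) = awalk_verts u p ! Suc i" using True by (simp add: verts' nth_append n_def)
    also have "\<dots> = snd (p ! i)" unfolding verts using that by (simp add: n_def)
    finally show ?thesis using True by simp
  next
    case False
    then have i: "Suc i = n" using that by simp
    then have "i = length p - 1" "p \<noteq> []" using n by (auto simp: n_def)
    then have "snd (p ! i) = last (awalk_verts u p)"
      unfolding verts' using last_conv_nth[of p] by simp
    also have "\<dots> = hd (awalk_verts u p)" using walk by auto
    also have "\<dots> = fst (p ! 0)" unfolding verts' using n
      by (cases p) (auto simp: n_def)
    finally show ?thesis using i by simp
  qed
  obtain i where i: "i < n" "\<And>j. j < n \<Longrightarrow> depth (snd (p ! j)) \<le> depth (snd (p ! i))"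
  proof -
    define M where "M = Max ((\<lambda>j. depth (snd (p ! j))) ` {..<n})"
    have "M \<in> (\<lambda>j. depth (snd (p ! j))) ` {..<n}" unfolding M_def using n
      by (intro Max_in) (auto simp: lessThan_empty_iff)
    then obtain i where "i < n" "depth (snd (p ! i)) = M" by auto
    moreover have "depth (snd (p ! j)) \<le> M" if "j < n" for j
      unfolding M_def using that by (intro Max_ge) auto
    ultimately show ?thesis using that by simp
  qed
  define x where "x = snd (p ! i)"
  have only_par: "y = par x" if "(x, y) \<in> parcs T \<or> (y, x) \<in> parcs T" "depth y \<le> depth x" for y
    using that depth_par[of y] by (auto simp: parcs_T_iff)
  define j where "j = (if i = 0 then n - 1 else i - 1)"
  define l where "l = Suc i mod n"
  have j: "j < n" "Suc j mod n = i" using i n by (auto simp: j_def)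
  have l: "l < n" using n by (simp add: l_def)
  have "j \<noteq> l" using i n by (cases "Suc i = n") (auto simp: j_def l_def)
  moreover have "snd (p ! j) = par x"
  proof (rule only_par)
    have "p ! i = (snd (p ! j), x)" using nxt[of j] j by (simp add: x_def prod_eq_iff)
    moreover have "p ! i \<in> parcs T" using walk i(1) by (auto simp: awalk_def n_def)
    ultimately show "(x, snd (p ! j)) \<in> parcs T \<or> (snd (p ! j), x) \<in> parcs T" by simp
    show "depth (snd (p ! j)) \<le> depth x" using i(2) j by (simp add: x_def)
  qed
  moreover have "snd (p ! l) = par x"
  proof (rule only_par)
    have "p ! l = (x, snd (p ! l))" using nxt[of i] i by (simp add: x_def l_def prod_eq_iff)
    moreover have "p ! l \<in> parcs T" using walk l by (auto simp: awalk_def n_def)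
    ultimately show "(x, snd (p ! l)) \<in> parcs T \<or> (snd (p ! l), x) \<in> parcs T" by simp
    show "depth (snd (p ! l)) \<le> depth x" using i(2) l by (simp add: x_def)
  qed
  ultimately show False
    using nth_eq_iff_index_eq[OF heads, of j l] j(1) l by (simp add: n_def)
qed

lemma undirected_tree_T: "undirected_tree T"
  unfolding undirected_tree_def using pair_graph connected_T no_long_cycle by fastforce

lemma childless_leaf:
  assumes "x \<in> V" "x \<noteq> root" "\<And>y. y \<in> V \<Longrightarrow> y \<noteq> root \<Longrightarrow> par y \<noteq> x"
  shows "x \<in> leaves T"
proof -
  have "(x, y) \<in> parcs T \<longleftrightarrow> y = par x" for y
    using assms by (auto simp: parcs_T_iff)
  then have "e \<in> out_arcs T x \<longleftrightarrow> e = (x, par x)" for e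
    unfolding out_arcs_def by (cases e) auto
  then have "out_arcs T x = {(x, par x)}" by blast
  then show ?thesis using assms(1) by (simp add: leaves_def out_degree_def)
qed

text \<open>A vertex with a child that is not the root has its own parent as a second neighbour.\<close>
lemma parent_not_leaf:
  assumes "y \<in> V" "y \<noteq> root" "par y \<noteq> root"
  shows "par y \<notin> leaves T"
proof (rule two_neighbours_not_leaf)
  show "(par y, y) \<in> parcs T" "(par y, par (par y)) \<in> parcs T"
    using assms par_in by (auto simp: parcs_T_iff)
  show "y \<noteq> par (par y)"
    using assms par_in depth_par by (metis Suc_n_not_le_n le_SucI order_refl)
qed

lemma two_children_not_leaf:
  assumes "y \<in> V" "y \<noteq> root" "z \<in> V" "z \<noteq> root" "par y = x" "par z = x" "y \<noteq> z"
  shows "x \<notin> leaves T"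
  using assms by (intro two_neighbours_not_leaf[of x y z]) (auto simp: parcs_T_iff)

lemma graph_dist_siblings:
  assumes "x \<in> V" "x \<noteq> root" "y \<in> V" "y \<noteq> root" "par x = par y"
  shows "graph_dist T x y \<le> 2"
proof -
  have "awalk x [(x, par x), (par x, y)] y"
    using assms par_in by (auto simp: awalk_simps parcs_T_iff)
  from graph_dist_le_walk[OF this] show ?thesis by simp
qed

text \<open>
  Here \<open>branch\<close> tells the subtrees hanging off the root apart. The walk through the root gives the
  upper bound. For the lower bound, let the depth count negatively on the branch of \<open>x\<close>: the value
  changes by 1 along every edge, also across the root, whose depth is 0 with either sign.
\<close>
lemma graph_dist_branches:
  assumes branch: "\<And>x. x \<in> V \<Longrightarrow> x \<noteq> root \<Longrightarrow> branch (par x) = branch x \<or> par x = root"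
    and "x \<in> V" "y \<in> V" "branch x \<noteq> branch y"
  shows "graph_dist T x y = ereal (real (depth x + depth y))"
proof (rule antisym)
  show "graph_dist T x y \<le> ereal (real (depth x + depth y))"
    using walk_via_root[OF assms(2,3)] graph_dist_le_walk by metis
  define f where "f z = (if branch z = branch x then - int (depth z) else int (depth z))" for z
  have up: "\<bar>f z - f (par z)\<bar> = 1" if "z \<in> V" "z \<noteq> root" for z
    using branch[OF that] depth_par[OF that] depth_root by (auto simp: f_def)
  have "ereal (real_of_int (f y - f x)) \<le> graph_dist T x y"
    by (rule lipschitz_le_graph_dist) (use up in \<open>force simp: parcs_T_iff\<close>)
  then show "ereal (real (depth x + depth y)) \<le> graph_dist T x y"
    using assms(4) by (simp add: f_def add.commute)
qed

end

section \<open>Spiders with leaf classes at their feet\<close>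

text \<open>
  The inner vertices must be natural numbers, so the vertex at distance \<open>j\<close> from the body on leg
  \<open>i\<close> is encoded as a pair. All legs start at the body, hence the index is dropped for \<open>j = 0\<close>.
\<close>
definition leg :: "nat \<Rightarrow> nat \<Rightarrow> 'a + nat" where
  "leg i j = Inr (prod_encode (if j = 0 then 0 else i, j))"

fun spider_par :: "('a \<Rightarrow> nat) \<Rightarrow> (nat \<Rightarrow> nat) \<Rightarrow> 'a + nat \<Rightarrow> 'a + nat" where
  "spider_par cls d (Inl v) = leg (cls v) (d (cls v))"
| "spider_par cls d (Inr n) = (case prod_decode n of (i, j) \<Rightarrow> leg i (j - 1))"

fun spider_depth :: "('a \<Rightarrow> nat) \<Rightarrow> (nat \<Rightarrow> nat) \<Rightarrow> 'a + nat \<Rightarrow> nat" where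
  "spider_depth cls d (Inl v) = Suc (d (cls v))"
| "spider_depth cls d (Inr n) = snd (prod_decode n)"

fun spider_branch :: "('a \<Rightarrow> nat) \<Rightarrow> 'a + nat \<Rightarrow> nat" where
  "spider_branch cls (Inl v) = cls v"
| "spider_branch cls (Inr n) = fst (prod_decode n)"

lemma leg_eq_iff [simp]: "leg i j = leg i' j' \<longleftrightarrow> j = j' \<and> (j = 0 \<or> i = i')"
  by (auto simp: leg_def prod_encode_eq)

lemma leg_simps [simp]:
  "leg i j \<noteq> Inl v" "Inl v \<noteq> leg i j"
  "spider_par cls d (leg i j) = leg i (j - 1)"
  "spider_depth cls d (leg i j) = j"
  "spider_branch cls (leg i j) = (if j = 0 then 0 else i)"
  by (auto simp: leg_def)

text \<open>
  The legs carry the leaf classes at their feet: a leaf of class \<open>i\<close> has depth \<open>d i + 1\<close>. Every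
  class is nonempty, so no foot is a leaf; the condition on \<open>s\<close> ensures that the body has two
  neighbours. A leg of length 0 means that its class is attached to the body directly.
\<close>
lemma tufted_spider:
  fixes A :: "'a set" and cls :: "'a \<Rightarrow> nat" and d :: "nat \<Rightarrow> nat"
  assumes "finite A" and cls: "cls ` A = {..<s}"
    and root_degree: "2 \<le> s \<or> d 0 = 0 \<and> 2 \<le> card A \<and> s = 1"
  obtains T :: "('a + nat) pair_pre_digraph"
  where "undirected_tree T" "leaves T = Inl ` A"
    and "\<And>u v. u \<in> A \<Longrightarrow> v \<in> A \<Longrightarrow> cls u \<noteq> cls v \<Longrightarrow>
           graph_dist T (Inl u) (Inl v) = ereal (real (d (cls u) + d (cls v) + 2))"
    and "\<And>u v. u \<in> A \<Longrightarrow> v \<in> A \<Longrightarrow> cls u = cls v \<Longrightarrow>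
           graph_dist T (Inl u) (Inl v) \<le> 2"
proof -
  define inner where "inner = (\<Union>i<s. \<Union>j\<le>d i. {leg i j :: 'a + nat})"
  define V where "V = Inl ` A \<union> inner"
  let ?r = "leg 0 0 :: 'a + nat" and ?par = "spider_par cls d" and ?dep = "spider_depth cls d"
  have inner_iff: "x \<in> inner \<longleftrightarrow> (\<exists>i<s. \<exists>j\<le>d i. x = leg i j)" for x
    by (auto simp: inner_def)
  have cls_less: "cls v < s" if "v \<in> A" for v using cls that by blast
  have cls_ex: "\<exists>v\<in>A. cls v = i" if "i < s" for i using cls that by (metis imageE lessThan_iff)
  have leg_in: "leg i j \<in> V" if "i < s" "j \<le> d i" for i j
    using that inner_iff unfolding V_def by blast
  have V_cases: thesis
    if "x \<in> V" "\<And>v. v \<in> A \<Longrightarrow> x = Inl v \<Longrightarrow> thesis"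
      "\<And>i j. i < s \<Longrightarrow> j \<le> d i \<Longrightarrow> x = leg i j \<Longrightarrow> thesis" for x thesis
    using that by (auto simp: V_def inner_iff)
  interpret B: parent_tree V ?r ?par ?dep
  proof
    show "finite V" using assms(1) by (simp add: V_def inner_def)
    show "?r \<in> V" using root_degree by (intro leg_in) auto
    show "?par x \<in> V" if "x \<in> V" "x \<noteq> ?r" for x
    proof (cases rule: V_cases[OF that(1)])
      case (1 v)
      then show ?thesis using cls_less leg_in by simp
    next
      case (2 i j)
      then show ?thesis using leg_in[of i "j - 1"] by simp
    qed
    show "?dep ?r = 0" by simp
    show "?dep x = Suc (?dep (?par x))" if "x \<in> V" "x \<noteq> ?r" for x
      using that(2) by (cases rule: V_cases[OF that(1)]) auto
  qed
  have child: "\<exists>y\<in>V. y \<noteq> ?r \<and> ?par y = leg i j \<and> spider_branch cls y = i"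
    if "i < s" "j \<le> d i" for i j
  proof (cases "j = d i")
    case True
    obtain v where "v \<in> A" "cls v = i" using cls_ex[OF \<open>i < s\<close>] by blast
    with True show ?thesis by (intro bexI[of _ "Inl v"]) (auto simp: V_def)
  next
    case False
    then have "leg i (Suc j) \<in> V" using that by (intro leg_in) auto
    then show ?thesis by (intro bexI[of _ "leg i (Suc j)"]) auto
  qed
  have leafI: "Inl v \<in> leaves B.T" if "v \<in> A" for v
  proof (rule B.childless_leaf)
    show "Inl v \<in> V" using that by (simp add: V_def)
    show "?par y \<noteq> Inl v" if "y \<in> V" for y
      by (cases rule: V_cases[OF that]) auto
  qed simp
  have root: "?r \<notin> leaves B.T"
    using root_degree
  proof
    assume "2 \<le> s"
    then obtain y z where "y \<in> V" "y \<noteq> ?r" "?par y = ?r" "spider_branch cls y = 0"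
      and "z \<in> V" "z \<noteq> ?r" "?par z = ?r" "spider_branch cls z = 1"
      using child[of 0 0] child[of 1 0] by auto
    moreover from this have "y \<noteq> z" by auto
    ultimately show ?thesis by (intro B.two_children_not_leaf[of y z])
  next
    assume s: "d 0 = 0 \<and> 2 \<le> card A \<and> s = 1"
    then obtain v w where "v \<in> A" "w \<in> A" "v \<noteq> w"
      by (metis One_nat_def Suc_1 card_le_Suc0_iff_eq assms(1) not_less_eq_eq)
    moreover from this have "cls v = 0" "cls w = 0" using cls_less s by auto
    ultimately show ?thesis using s B.two_children_not_leaf[of "Inl v" "Inl w" ?r]
      by (simp add: V_def)
  qed
  have inner: "x \<notin> leaves B.T" if "x \<in> inner" for x
  proof (cases "x = ?r")
    case False
    from that obtain i j where "i < s" "j \<le> d i" and x: "x = leg i j"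
      unfolding inner_iff by auto
    from child[OF this(1,2)] obtain y where "y \<in> V" "y \<noteq> ?r" "?par y = x"
      unfolding x by auto
    with False show ?thesis using B.parent_not_leaf by metis
  qed (simp add: root del: leg_eq_iff)
  have "leaves B.T \<subseteq> V" using B.pverts_T unfolding leaves_def by blast
  with leafI inner have leaves: "leaves B.T = Inl ` A" unfolding V_def by blast
  show thesis
  proof (rule that[OF B.undirected_tree_T leaves])
    fix u v assume uv: "u \<in> A" "v \<in> A" "cls u \<noteq> cls v"
    have "graph_dist B.T (Inl u) (Inl v) = ereal (real (?dep (Inl u) + ?dep (Inl v)))"
    proof (rule B.graph_dist_branches)
      show "spider_branch cls (?par x) = spider_branch cls x \<or> ?par x = ?r"
        if "x \<in> V" "x \<noteq> ?r" for x
        by (cases rule: V_cases[OF that(1)]) auto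
    qed (use uv in \<open>auto simp: V_def\<close>)
    then show "graph_dist B.T (Inl u) (Inl v) = ereal (real (d (cls u) + d (cls v) + 2))"
      by simp
  next
    fix u v assume "u \<in> A" "v \<in> A" "cls u = cls v"
    then show "graph_dist B.T (Inl u) (Inl v) \<le> 2"
      by (intro B.graph_dist_siblings) (auto simp: V_def)
  qed
qed

lemma one_vertex_tree:
  obtains T :: "'v pair_pre_digraph" where "undirected_tree T" "leaves T = {v}"
proof -
  interpret B: parent_tree "{v}" v id "\<lambda>_. 0" by unfold_locales auto
  have "leaves B.T = {v}" by (auto simp: leaves_def)
  with B.undirected_tree_T that show thesis by blast
qed

section \<open>Complete multipartite graphs\<close>

lemma complete_multipartite_classes:
  assumes "complete_multipartite ns G" "\<forall>n \<in> set ns. n \<ge> 1"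
  obtains cls where "cls ` pverts G = {..<length ns}"
    and "\<And>u v. u \<in> pverts G \<Longrightarrow> v \<in> pverts G \<Longrightarrow> (u, v) \<in> parcs G \<longleftrightarrow> cls u \<noteq> cls v"
proof -
  obtain V where V: "pverts G = (\<Union>i<length ns. V i)"
    "disjoint_family_on V {..<length ns}" "\<forall>i<length ns. card (V i) = ns ! i"
    "parcs G = {(u, v). \<exists>i<length ns. \<exists>j<length ns. i \<noteq> j \<and> u \<in> V i \<and> v \<in> V j}"
    using assms(1) unfolding complete_multipartite_def by blast
  define cls where "cls v = (THE i. i < length ns \<and> v \<in> V i)" for v
  have cls: "cls v = i" if "i < length ns" "v \<in> V i" for i v
    unfolding cls_def using that V(2)
    by (intro the_equality) (auto simp: disjoint_family_on_def)
  have ne: "V i \<noteq> {}" if "i < length ns" for i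
    using that V(3) assms(2) nth_mem by fastforce
  show thesis
  proof (rule that[of cls])
    show "cls ` pverts G = {..<length ns}"
    proof
      show "cls ` pverts G \<subseteq> {..<length ns}" using cls V(1) by auto
      show "{..<length ns} \<subseteq> cls ` pverts G" using cls V(1) ne by (fastforce simp: image_iff)
    qed
    show "(u, v) \<in> parcs G \<longleftrightarrow> cls u \<noteq> cls v" if "u \<in> pverts G" "v \<in> pverts G" for u v
      using that cls unfolding V(1,4) by auto
  qed
qed

theorem theorem6p2:
  fixes k :: nat and ns :: "nat list" and G :: "'a pair_pre_digraph"
  assumes "k \<ge> 3"
    and "length ns \<ge> 1"
    and "\<forall>n \<in> set ns. n \<ge> 1"
    and "complete_multipartite ns G"
  shows "exact_leaf_power k G \<longleftrightarrow> even k \<or> length ns \<le> 2"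
proof -
  obtain cls where cls: "cls ` pverts G = {..<length ns}"
    and arcs: "\<And>u v. u \<in> pverts G \<Longrightarrow> v \<in> pverts G \<Longrightarrow> (u, v) \<in> parcs G \<longleftrightarrow> cls u \<noteq> cls v"
    using complete_multipartite_classes assms(3,4) by blast
  have fin: "finite (pverts G)"
    using assms(4) by (simp add: complete_multipartite_def pair_graph_def pair_digraph_def
        pair_fin_digraph_def pair_fin_digraph_axioms_def)
  show ?thesis
  proof
    assume "exact_leaf_power k G"
    then obtain T :: "('a + nat) pair_pre_digraph" where T: "undirected_tree T"
      "\<And>u v. u \<in> pverts G \<Longrightarrow> v \<in> pverts G \<Longrightarrow> u \<noteq> v \<Longrightarrow>
         (u, v) \<in> parcs G \<longleftrightarrow> graph_dist T (Inl u) (Inl v) = ereal (real k)"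
      unfolding exact_leaf_power_def by blast
    show "even k \<or> length ns \<le> 2"
    proof (rule ccontr)
      assume "\<not> (even k \<or> length ns \<le> 2)"
      then have "odd k" and "{0, 1, 2} \<subseteq> cls ` pverts G" unfolding cls by auto
      then obtain x y z where xyz: "x \<in> pverts G" "y \<in> pverts G" "z \<in> pverts G"
        "cls x = 0" "cls y = 1" "cls z = 2"
        unfolding insert_subset image_iff by (metis (no_types))
      then have "x \<noteq> y" "y \<noteq> z" "z \<noteq> x" by auto
      with xyz have "graph_dist T (Inl x) (Inl y) = ereal (real k)"
        "graph_dist T (Inl y) (Inl z) = ereal (real k)"
        "graph_dist T (Inl z) (Inl x) = ereal (real k)"
        by (simp_all flip: T(2) add: arcs)
      then show False by (rule no_three_equidistant_odd[OF T(1) \<open>odd k\<close>])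
    qed
  next
    assume cond: "even k \<or> length ns \<le> 2"
    show "exact_leaf_power k G"
    proof (cases "length ns = 1 \<and> card (pverts G) = 1")
      case True
      then obtain v where v: "pverts G = {v}" by (meson card_1_singletonE)
      obtain T :: "('a + nat) pair_pre_digraph" where "undirected_tree T" "leaves T = {Inl v}"
        by (rule one_vertex_tree)
      then show ?thesis unfolding exact_leaf_power_def v by (intro exI[of _ T]) simp
    next
      case False
      \<comment> \<open>The lengths satisfy \<open>d i + d j + 2 = k\<close> for \<open>i \<noteq> j\<close>; the value for a single class
          yields a star.\<close>
      define d where "d i = (if length ns = 1 then 0
        else if length ns = 2 then (if i = 0 then 0 else k - 2) else k div 2 - 1)" for i :: nat
      have "0 \<in> cls ` pverts G" using assms(2) unfolding cls by (cases ns) auto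
      then have "card (pverts G) \<noteq> 0" using fin by auto
      then have body: "2 \<le> length ns \<or> d 0 = 0 \<and> 2 \<le> card (pverts G) \<and> length ns = 1"
        using False assms(2) by (auto simp: d_def)
      obtain T :: "('a + nat) pair_pre_digraph" where T: "undirected_tree T" "leaves T = Inl ` pverts G"
        and across: "\<And>u v. u \<in> pverts G \<Longrightarrow> v \<in> pverts G \<Longrightarrow> cls u \<noteq> cls v \<Longrightarrow>
           graph_dist T (Inl u) (Inl v) = ereal (real (d (cls u) + d (cls v) + 2))"
        and within: "\<And>u v. u \<in> pverts G \<Longrightarrow> v \<in> pverts G \<Longrightarrow> cls u = cls v \<Longrightarrow>
           graph_dist T (Inl u) (Inl v) \<le> 2"
        by (rule tufted_spider[of "pverts G" cls "length ns" d, OF fin cls body]) (rule that; simp)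
      have "d i + d j + 2 = k" if "i < length ns" "j < length ns" "i \<noteq> j" for i j
        using that cond assms(1) by (auto simp: d_def elim!: evenE)
      then have apart: "graph_dist T (Inl u) (Inl v) = ereal (real k)"
        if "u \<in> pverts G" "v \<in> pverts G" "cls u \<noteq> cls v" for u v
        using across[OF that] that cls by (metis imageI lessThan_iff)
      have close: "graph_dist T (Inl u) (Inl v) \<noteq> ereal (real k)"
        if "u \<in> pverts G" "v \<in> pverts G" "cls u = cls v" for u v
        using within[OF that] assms(1) by auto
      show ?thesis
        unfolding exact_leaf_power_def
      proof (intro exI[of _ T] conjI ballI impI T)
        fix u v assume uv: "u \<in> pverts G" "v \<in> pverts G"
        show "(u, v) \<in> parcs G \<longleftrightarrow> graph_dist T (Inl u) (Inl v) = ereal (real k)"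
          using apart[OF uv] close[OF uv] unfolding arcs[OF uv] by blast
      qed
    qed
  qed
qed

end
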